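(* Let $X,Y,Z$ be graphs. Suppose $\operatorname{wir}^k_{X\to Y}$ and $\operatorname{wir}^l_{Y\to Z}$ take finite values. Then $$\operatorname{wir}^{kl}_{X\to Z}(n)\leq\operatorname{wir}^l_{Y\to Z}\left(\operatorname{wir}^k_{X\to Y}(n)\right).$$
   Context: A graph $\Gamma=(V\Gamma,E\Gamma)$ consists of a set $V\Gamma$ of vertices and a set $E\Gamma$ of unordered pairs of distinct vertices (edges). $\Gamma$ also denotes its topological realisation (one unit interval for each edge, with endpoints labelled by the same vertex identified). $|\Gamma|$ is the number of vertices, and $\Gamma\leq X$ means $\Gamma$ is a subgraph of $X$. A wiring of a graph $\Gamma$ into a graph $\Gamma'$ is a continuous map $f:\Gamma\to\Gamma'$ such that the image of each vertex is a vertex and the image of each edge is a walk in $\Gamma'$. It is a coarse $k$-wiring if (1) the preimage of each vertex of $\Gamma'$ contains at most $k$ vertices of $\Gamma$, and (2) each edge of $\Gamma'$ is contained in the image of at most $k$ edges of $\Gamma$. The image of a wiring is the subgraph of $\Gamma'$ consisting of all vertices in $f(V\Gamma)$ and all walks which are images of edges; the volume of a wiring is the number of vertices in its image. For a finite graph $\Gamma$ and a graph $Y$, $\operatorname{wir}^k(\Gamma\to Y)$ is the minimal volume of a coarse $k$-wiring of $\Gamma$ into $Y$ ($+\infty$ if none exists). The $k$-wiring profile of $X$ into $Y$ is $\operatorname{wir}^k_{X\to Y}(n)=\max\{\operatorname{wir}^k(\Gamma\to Y) : \Gamma\leq X,\ |\Gamma|\leq n\}$. *)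

theory Defs
  imports "HOL-Analysis.Analysis" "HOL-Library.Extended_Nat"
begin

record 'a graph =
  verts :: "'a set"
  edges :: "'a set set"

definition is_graph :: "'a graph \<Rightarrow> bool" where
  "is_graph G \<longleftrightarrow>
     (\<forall>e\<in>edges G. \<exists>u v. e = {u, v} \<and> u \<noteq> v \<and> u \<in> verts G \<and> v \<in> verts G)"

definition subgraph :: "'a graph \<Rightarrow> 'a graph \<Rightarrow> bool" where
  "subgraph H G \<longleftrightarrow> is_graph H \<and> verts H \<subseteq> verts G \<and> edges H \<subseteq> edges G"

text \<open>Points of the topological realisation are written in barycentric coordinates on the
  vertex set. The map \<open>edge_point u v\<close>, restricted to the unit interval, parametrises the
  edge \<open>{u, v}\<close> from \<open>u\<close> to \<open>v\<close>; the endpoints of different edges labelled by the same vertex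
  are thereby the same point.\<close>

definition vertex_point :: "'a \<Rightarrow> ('a \<Rightarrow> real)" where
  "vertex_point v = (\<lambda>x. if x = v then 1 else 0)"

definition edge_point :: "'a \<Rightarrow> 'a \<Rightarrow> real \<Rightarrow> ('a \<Rightarrow> real)" where
  "edge_point u v t = (\<lambda>x. (1 - t) * vertex_point u x + t * vertex_point v x)"

definition edge_space :: "'a set \<Rightarrow> ('a \<Rightarrow> real) set" where
  "edge_space e = {edge_point u v t |u v t. e = {u, v} \<and> t \<in> {0..1}}"

definition graph_space :: "'a graph \<Rightarrow> ('a \<Rightarrow> real) set" where
  "graph_space G = vertex_point ` verts G \<union> (\<Union>e\<in>edges G. edge_space e)"

text \<open>The quotient topology of the disjoint union of the (discrete) vertex set and one unit
  interval for each edge: a set is open iff its preimage in every such interval is open. In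
  general this differs from the subspace topology inherited from the function space.\<close>

definition realisation :: "'a graph \<Rightarrow> ('a \<Rightarrow> real) topology" where
  "realisation G = topology (\<lambda>U. U \<subseteq> graph_space G \<and>
     (\<forall>u v. {u, v} \<in> edges G \<longrightarrow>
        openin (top_of_set {0..1}) {t \<in> {0..1}. edge_point u v t \<in> U}))"

lemma openin_realisation:
  "openin (realisation G) U \<longleftrightarrow> U \<subseteq> graph_space G \<and>
     (\<forall>u v. {u, v} \<in> edges G \<longrightarrow>
        openin (top_of_set {0..1}) {t \<in> {0..1}. edge_point u v t \<in> U})"
proof -
  have "istopology (\<lambda>U. U \<subseteq> graph_space G \<and>
     (\<forall>u v. {u, v} \<in> edges G \<longrightarrow>
        openin (top_of_set {0..1::real}) {t \<in> {0..1}. edge_point u v t \<in> U}))"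
    (is "istopology ?P")
    unfolding istopology_def
  proof (intro conjI allI impI)
    fix S T u v assume S: "?P S" and T: "?P T" and e: "{u, v} \<in> edges G"
    have "{t \<in> {0..1}. edge_point u v t \<in> S \<inter> T} =
        {t \<in> {0..1}. edge_point u v t \<in> S} \<inter> {t \<in> {0..1}. edge_point u v t \<in> T}"
      by auto
    then show "openin (top_of_set {0..1}) {t \<in> {0..1}. edge_point u v t \<in> S \<inter> T}"
      using S T e by (metis (no_types, lifting) openin_Int)
  next
    fix K u v assume K: "\<forall>S\<in>K. ?P S" and e: "{u, v} \<in> edges G"
    have "{t \<in> {0..1}. edge_point u v t \<in> \<Union>K} =
        (\<Union>S\<in>K. {t \<in> {0..1}. edge_point u v t \<in> S})"
      by auto
    moreover have "openin (top_of_set {0..1}) (\<Union>S\<in>K. {t \<in> {0..1}. edge_point u v t \<in> S})"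
      using K e by (intro openin_Union) auto
    ultimately show "openin (top_of_set {0..1}) {t \<in> {0..1}. edge_point u v t \<in> \<Union>K}"
      by simp
  qed blast+
  then show ?thesis
    unfolding realisation_def by (simp add: topology_inverse')
qed

lemma topspace_realisation: "topspace (realisation G) = graph_space G"
proof
  show "topspace (realisation G) \<subseteq> graph_space G"
    using openin_realisation[of G "topspace (realisation G)"] by simp
  have "{t \<in> {0..1}. edge_point u v t \<in> graph_space G} = {0..1}"
    if "{u, v} \<in> edges G" for u v
    using that unfolding graph_space_def edge_space_def by blast
  then have "openin (realisation G) (graph_space G)"
    unfolding openin_realisation by (metis openin_topspace order_refl topspace_euclidean_subtopology)
  then show "graph_space G \<subseteq> topspace (realisation G)"
    by (rule openin_subset)
qed

text \<open>Walks may have length zero, i.e. an edge may be mapped to a single vertex.\<close>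

definition walk :: "'a graph \<Rightarrow> 'a list \<Rightarrow> bool" where
  "walk G w \<longleftrightarrow> w \<noteq> [] \<and> set w \<subseteq> verts G \<and>
     (\<forall>i. Suc i < length w \<longrightarrow> {w ! i, w ! Suc i} \<in> edges G)"

definition walk_space :: "'a list \<Rightarrow> ('a \<Rightarrow> real) set" where
  "walk_space w = vertex_point ` set w \<union>
     (\<Union>i\<in>{i. Suc i < length w}. edge_space {w ! i, w ! Suc i})"

text \<open>The walk is asked to join the images of the endpoints. This is no restriction: these
  images are vertices on the walk, so it can be extended by retracing its own edges.\<close>

definition wiring :: "'a graph \<Rightarrow> 'b graph \<Rightarrow> (('a \<Rightarrow> real) \<Rightarrow> ('b \<Rightarrow> real)) \<Rightarrow> bool" where
  "wiring G H f \<longleftrightarrow>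
     continuous_map (realisation G) (realisation H) f \<and>
     (\<forall>v\<in>verts G. f (vertex_point v) \<in> vertex_point ` verts H) \<and>
     (\<forall>u v. {u, v} \<in> edges G \<longrightarrow>
        (\<exists>w. walk H w \<and> f (vertex_point u) = vertex_point (hd w) \<and>
             f (vertex_point v) = vertex_point (last w) \<and>
             f ` edge_space {u, v} = walk_space w))"

definition coarse_wiring ::
  "nat \<Rightarrow> 'a graph \<Rightarrow> 'b graph \<Rightarrow> (('a \<Rightarrow> real) \<Rightarrow> ('b \<Rightarrow> real)) \<Rightarrow> bool" where
  "coarse_wiring k G H f \<longleftrightarrow> wiring G H f \<and>
     (\<forall>y\<in>verts H. finite {x \<in> verts G. f (vertex_point x) = vertex_point y} \<and>
        card {x \<in> verts G. f (vertex_point x) = vertex_point y} \<le> k) \<and>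
     (\<forall>d\<in>edges H. finite {e \<in> edges G. edge_space d \<subseteq> f ` edge_space e} \<and>
        card {e \<in> edges G. edge_space d \<subseteq> f ` edge_space e} \<le> k)"

definition wiring_image ::
  "'a graph \<Rightarrow> 'b graph \<Rightarrow> (('a \<Rightarrow> real) \<Rightarrow> ('b \<Rightarrow> real)) \<Rightarrow> 'b graph" where
  "wiring_image G H f = \<lparr>
     verts = {y \<in> verts H. vertex_point y \<in> f ` vertex_point ` verts G \<or>
                           (\<exists>e\<in>edges G. vertex_point y \<in> f ` edge_space e)},
     edges = {d \<in> edges H. \<exists>e\<in>edges G. edge_space d \<subseteq> f ` edge_space e}\<rparr>"

text \<open>Only used for wirings of finite graphs, whose image is finite.\<close>

definition wiring_volume ::
  "'a graph \<Rightarrow> 'b graph \<Rightarrow> (('a \<Rightarrow> real) \<Rightarrow> ('b \<Rightarrow> real)) \<Rightarrow> nat" where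
  "wiring_volume G H f = card (verts (wiring_image G H f))"

text \<open>The infimum of a nonempty set of extended naturals is attained; that of the empty set
  is \<open>\<infinity>\<close>.\<close>

definition wir :: "nat \<Rightarrow> 'a graph \<Rightarrow> 'b graph \<Rightarrow> enat" where
  "wir k G Y = (INF f\<in>{f. coarse_wiring k G Y f}. enat (wiring_volume G Y f))"

text \<open>The family always contains the empty graph, so the supremum is a maximum whenever it is
  finite.\<close>

definition wiring_profile :: "nat \<Rightarrow> 'a graph \<Rightarrow> 'b graph \<Rightarrow> nat \<Rightarrow> enat" where
  "wiring_profile k X Y n =
     (SUP G\<in>{G. subgraph G X \<and> finite (verts G) \<and> card (verts G) \<le> n}. wir k G Y)"

end

theory Submission
  imports Defs
begin

text \<open>An optimal wiring \<open>f\<close> of a finite subgraph of \<open>X\<close> into \<open>Y\<close> is composed with an optimal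
  wiring \<open>g\<close> of the image of \<open>f\<close>, which is a subgraph of \<open>Y\<close> with at most
  \<open>wiring_profile k X Y n\<close> vertices. Two points need care. First, \<open>f\<close> has to be continuous as a
  map into the realisation of its image; this holds because closed sets of the realisation of a
  subgraph are closed in the whole realisation. Secondly, if \<open>g \<circ> f\<close> maps an edge \<open>e\<close> over an
  edge \<open>d\<close>, then, looking at the midpoint of \<open>d\<close>, already a single edge of the walk \<open>f e\<close> is
  mapped over \<open>d\<close>; this gives the multiplicity bound \<open>k * l\<close>.\<close>

section \<open>Points and walks\<close>

lemma edge_point_0 [simp]: "edge_point u v 0 = vertex_point u"
  by (simp add: edge_point_def)

lemma edge_point_1 [simp]: "edge_point u v 1 = vertex_point v"
  by (simp add: edge_point_def)

lemma vertex_point_eq_iff [simp]: "vertex_point u = vertex_point v \<longleftrightarrow> u = v"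
  by (metis vertex_point_def zero_neq_one)

lemma edge_point_in_edge_space: "t \<in> {0..1} \<Longrightarrow> edge_point u v t \<in> edge_space {u, v}"
  unfolding edge_space_def by blast

lemma vertex_point_in_edge_space [simp]:
  "vertex_point u \<in> edge_space {u, v}" "vertex_point v \<in> edge_space {u, v}"
  using edge_point_in_edge_space[of 0 u v] edge_point_in_edge_space[of 1 u v] by auto

text \<open>Barycentric coordinates allow an edge to be recovered from its points: a nonzero
  coordinate can only come from one of the two endpoints.\<close>

lemma edge_space_support: "p \<in> edge_space e \<Longrightarrow> p x \<noteq> 0 \<Longrightarrow> x \<in> e"
  unfolding edge_space_def edge_point_def vertex_point_def by (auto split: if_splits)

lemma vertex_point_in_edge_space_iff: "vertex_point y \<in> edge_space {u, v} \<longleftrightarrow> y \<in> {u, v}"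
proof -
  have "vertex_point y y \<noteq> 0" by (simp add: vertex_point_def)
  then show ?thesis using edge_space_support[of "vertex_point y" "{u, v}" y] by auto
qed

lemma edge_point_interior:
  assumes "u \<noteq> v" "0 < t" "t < 1"
  shows "edge_point u v t u \<noteq> 0" "edge_point u v t v \<noteq> 0"
  using assms by (simp_all add: edge_point_def vertex_point_def)

lemma edge_point_interior_neq_vertex_point:
  assumes "u \<noteq> v" "0 < t" "t < 1"
  shows "edge_point u v t \<noteq> vertex_point y"
  using edge_point_interior[OF assms] assms(1) by (metis vertex_point_def)

text \<open>The coordinates at \<open>u\<close> and at \<open>v\<close> are both nonzero, which
  forces both vertices into \<open>{a, b}\<close>; being distinct, they fill it.\<close>

lemma edge_point_interior_unique_edge:
  assumes "u \<noteq> v" "0 < t" "t < 1" "edge_point u v t \<in> edge_space {a, b}"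
  shows "{a, b} = {u, v}"
  using edge_space_support[OF assms(4)] edge_point_interior[OF assms(1-3)] assms(1) by blast

lemma is_graph_edgeE:
  assumes "is_graph G" "e \<in> edges G"
  obtains u v where "e = {u, v}" "u \<noteq> v" "u \<in> verts G" "v \<in> verts G"
  using assms unfolding is_graph_def by blast

lemma finite_edges: "is_graph G \<Longrightarrow> finite (verts G) \<Longrightarrow> finite (edges G)"
  by (rule finite_subset[of _ "Pow (verts G)"]) (auto elim: is_graph_edgeE)

section \<open>Walks, the sets they trace, and concatenation\<close>

lemma vertex_point_in_walk_space_iff: "vertex_point y \<in> walk_space w \<longleftrightarrow> y \<in> set w"
  unfolding walk_space_def by (auto simp: vertex_point_in_edge_space_iff)

lemma edge_space_subset_walk_space:
  "Suc i < length w \<Longrightarrow> edge_space {w ! i, w ! Suc i} \<subseteq> walk_space w"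
  unfolding walk_space_def by blast

text \<open>A point that is no vertex must come from an edge of the walk, and it determines that
  edge. This all-or-nothing behaviour later upgrades a single covered point to a whole covered
  edge.\<close>

lemma interior_in_walk_space:
  assumes "u \<noteq> v" "0 < t" "t < 1" "edge_point u v t \<in> walk_space w"
  shows "edge_space {u, v} \<subseteq> walk_space w"
proof -
  obtain i where "Suc i < length w" "edge_point u v t \<in> edge_space {w ! i, w ! Suc i}"
    using assms(4) edge_point_interior_neq_vertex_point[OF assms(1-3)]
    unfolding walk_space_def by auto
  then show ?thesis
    using edge_point_interior_unique_edge[OF assms(1-3)] edge_space_subset_walk_space by metis
qed

lemma walk_space_singleton [simp]: "walk_space [a] = {vertex_point a}"
  by (simp add: walk_space_def)

lemma walk_space_Cons:
  assumes "w \<noteq> []"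
  shows "walk_space (a # w) = edge_space {a, hd w} \<union> walk_space w"
proof -
  \<comment> \<open>Index 0 is the new first edge; the shifted indices are the edges of
    \<open>w\<close>.\<close>
  have "{i. Suc i < length (a # w)} = insert 0 (Suc ` {i. Suc i < length w})"
    using assms by (auto simp: image_iff) (metis not0_implies_Suc)
  then show ?thesis
    using assms unfolding walk_space_def by (auto simp: hd_conv_nth)
qed

lemma walk_singleton [simp]: "walk G [a] \<longleftrightarrow> a \<in> verts G"
  by (simp add: walk_def)

lemma walk_Cons:
  "w \<noteq> [] \<Longrightarrow> walk G (a # w) \<longleftrightarrow> a \<in> verts G \<and> {a, hd w} \<in> edges G \<and> walk G w"
  unfolding walk_def by (auto simp: hd_conv_nth All_less_Suc2 nth_Cons split: nat.splits)

text \<open>Taking \<open>tl w\<close> avoids repeating the vertex at which the two walks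
  meet.\<close>

lemma walk_append:
  assumes "walk G v" "walk G w" "last v = hd w"
  shows "walk G (v @ tl w)" "hd (v @ tl w) = hd v" "last (v @ tl w) = last w"
    "walk_space (v @ tl w) = walk_space v \<union> walk_space w"
proof -
  have w: "w \<noteq> []" and v: "v \<noteq> []" using assms by (auto simp: walk_def)
  show "hd (v @ tl w) = hd v" using v by simp
  show "last (v @ tl w) = last w"
    using v w assms(3) by (cases w) (auto simp: last_append)
  have "walk G (v @ tl w) \<and> walk_space (v @ tl w) = walk_space v \<union> walk_space w"
    using v assms(1,3)
  proof (induction v rule: list_nonempty_induct)
    case (single x)
    then have "[x] @ tl w = w" using w by (cases w) auto
    then show ?case
      using assms(2) single w vertex_point_in_walk_space_iff[of x w] by (cases w) auto
  next
    case (cons x xs)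
    then show ?case by (auto simp: walk_Cons walk_space_Cons)
  qed
  then show "walk G (v @ tl w)" "walk_space (v @ tl w) = walk_space v \<union> walk_space w"
    by auto
qed

section \<open>The topology of a subgraph\<close>

lemma edge_point_in_graph_space:
  assumes "{u, v} \<in> edges G" "t \<in> {0..1}"
  shows "edge_point u v t \<in> graph_space G"
  using assms(1) edge_point_in_edge_space[OF assms(2), of u v] by (auto simp: graph_space_def)

text \<open>Closed sets are the convenient ones for subgraphs: a set open in a subgraph is in
  general not open in the whole graph, since further edges may leave its vertices.\<close>

lemma closedin_realisation:
  "closedin (realisation G) C \<longleftrightarrow> C \<subseteq> graph_space G \<and>
     (\<forall>u v. {u, v} \<in> edges G \<longrightarrow>
        closedin (top_of_set {0..1}) {t \<in> {0..1}. edge_point u v t \<in> C})"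
proof -
  have "{t \<in> {0..1}. edge_point u v t \<in> graph_space G - C} =
      {0..1} - {t \<in> {0..1}. edge_point u v t \<in> C}" if "{u, v} \<in> edges G" for u v
    using edge_point_in_graph_space[OF that] by blast
  then show ?thesis
    by (auto simp: closedin_def openin_realisation topspace_realisation)
qed

lemma graph_space_mono: "subgraph H G \<Longrightarrow> graph_space H \<subseteq> graph_space G"
  unfolding subgraph_def graph_space_def by blast

lemma closedin_realisation_subgraph:
  assumes G: "is_graph G" and H: "subgraph H G" and C: "closedin (realisation H) C"
  shows "closedin (realisation G) C"
  unfolding closedin_realisation
proof (intro conjI allI impI)
  show "C \<subseteq> graph_space G"
    using C graph_space_mono[OF H] unfolding closedin_realisation by blast
  fix u v assume e: "{u, v} \<in> edges G"
  show "closedin (top_of_set {0..1}) {t \<in> {0..1}. edge_point u v t \<in> C}"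
  proof (cases "{u, v} \<in> edges H")
    case True
    then show ?thesis using C unfolding closedin_realisation by blast
  next
    case False
    have "u \<noteq> v" using G e by (auto elim!: is_graph_edgeE simp: doubleton_eq_iff)
    \<comment> \<open>On an edge missing from \<open>H\<close>, the set \<open>C\<close> meets at
      most the endpoints: an interior point would lie on some edge of \<open>H\<close>, which would
      have to be this very edge.\<close>
    have "t \<in> {0, 1}" if t: "t \<in> {0..1}" "edge_point u v t \<in> C" for t
    proof (rule ccontr)
      assume "t \<notin> {0, 1}"
      with t have t': "0 < t" "t < 1" by auto
      have "edge_point u v t \<in> graph_space H"
        using t(2) C unfolding closedin_realisation by blast
      then obtain d where d: "d \<in> edges H" "edge_point u v t \<in> edge_space d"
        using edge_point_interior_neq_vertex_point[OF \<open>u \<noteq> v\<close> t']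
        unfolding graph_space_def by auto
      have "is_graph H" using H by (simp add: subgraph_def)
      then obtain a b where "d = {a, b}" using d(1) by (rule is_graph_edgeE)
      then show False
        using d False edge_point_interior_unique_edge[OF \<open>u \<noteq> v\<close> t'] by metis
    qed
    then have "{t \<in> {0..1}. edge_point u v t \<in> C} \<subseteq> {0, 1}"
      by blast
    then have "closed {t \<in> {0..1}. edge_point u v t \<in> C}"
      by (meson finite.emptyI finite.insertI finite_imp_closed finite_subset)
    then show ?thesis
      by (simp add: closed_subset subset_iff)
  qed
qed

text \<open>A closed set of the subgraph is closed in the whole graph, so its preimage is already
  known to be closed.\<close>

lemma continuous_map_into_subgraph:
  assumes "is_graph G" "subgraph H G" "continuous_map T (realisation G) f"
    and "f \<in> topspace T \<rightarrow> graph_space H"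
  shows "continuous_map T (realisation H) f"
  using assms closedin_realisation_subgraph[OF assms(1,2)]
  unfolding continuous_map_closedin topspace_realisation by auto

section \<open>Wirings and their images\<close>

lemma wiring_edgeE:
  assumes "wiring G H f" "{u, v} \<in> edges G"
  obtains w where "walk H w" "f (vertex_point u) = vertex_point (hd w)"
    "f (vertex_point v) = vertex_point (last w)" "f ` edge_space {u, v} = walk_space w"
  using assms unfolding wiring_def by blast

lemma subgraph_wiring_image:
  assumes H: "is_graph H"
  shows "subgraph (wiring_image G H f) H"
  unfolding subgraph_def is_graph_def
proof (intro conjI ballI)
  fix d assume d: "d \<in> edges (wiring_image G H f)"
  then have "d \<in> edges H" by (simp add: wiring_image_def)
  with H obtain u v where uv: "d = {u, v}" "u \<noteq> v" "u \<in> verts H" "v \<in> verts H"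
    by (rule is_graph_edgeE)
  obtain e where e: "e \<in> edges G" "edge_space {u, v} \<subseteq> f ` edge_space e"
    using d uv(1) by (auto simp: wiring_image_def)
  then have "vertex_point u \<in> f ` edge_space e" "vertex_point v \<in> f ` edge_space e"
    by (meson subsetD vertex_point_in_edge_space)+
  then have "u \<in> verts (wiring_image G H f)" "v \<in> verts (wiring_image G H f)"
    using e(1) uv(3,4) unfolding wiring_image_def by auto
  with uv show "\<exists>u v. d = {u, v} \<and> u \<noteq> v \<and> u \<in> verts (wiring_image G H f) \<and>
      v \<in> verts (wiring_image G H f)" by blast
qed (auto simp: wiring_image_def)

text \<open>All vertices and edges of a walk traced inside the image of one edge are recorded in the
  image, so walks witnessing a wiring into \<open>H\<close> also serve for its image.\<close>

lemma walk_wiring_image: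
  assumes "walk H w" "e \<in> edges G" "walk_space w \<subseteq> f ` edge_space e"
  shows "walk (wiring_image G H f) w"
proof -
  have "x \<in> verts (wiring_image G H f)" if "x \<in> set w" for x
    using that assms vertex_point_in_walk_space_iff[of x w]
    unfolding walk_def wiring_image_def by auto
  moreover have "{w ! i, w ! Suc i} \<in> edges (wiring_image G H f)" if "Suc i < length w" for i
    using that assms edge_space_subset_walk_space[OF that]
    unfolding walk_def wiring_image_def by auto
  ultimately show ?thesis using assms(1) unfolding walk_def by blast
qed

lemma walk_space_subset_graph_space: "walk G w \<Longrightarrow> walk_space w \<subseteq> graph_space G"
  unfolding walk_def walk_space_def graph_space_def by blast

text \<open>This makes \<open>f\<close> composable with a wiring whose domain is only the image of
  \<open>f\<close>.\<close>

lemma wiring_into_image: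
  assumes G: "is_graph G" and H: "is_graph H" and f: "wiring G H f"
  shows "wiring G (wiring_image G H f) f"
proof -
  let ?I = "wiring_image G H f"
  have verts: "f (vertex_point v) \<in> vertex_point ` verts ?I" if v: "v \<in> verts G" for v
  proof -
    obtain y where "y \<in> verts H" "f (vertex_point v) = vertex_point y"
      using f v unfolding wiring_def by blast
    moreover from this have "vertex_point y \<in> f ` vertex_point ` verts G"
      using v by (metis imageI)
    ultimately show ?thesis by (auto simp: wiring_image_def)
  qed
  have edges: "\<exists>w. walk ?I w \<and> f (vertex_point u) = vertex_point (hd w) \<and>
      f (vertex_point v) = vertex_point (last w) \<and> f ` edge_space {u, v} = walk_space w"
    if e: "{u, v} \<in> edges G" for u v
  proof -
    obtain w where "walk H w" "f (vertex_point u) = vertex_point (hd w)"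
      "f (vertex_point v) = vertex_point (last w)" "f ` edge_space {u, v} = walk_space w"
      using f e by (rule wiring_edgeE)
    then show ?thesis using walk_wiring_image[OF _ e] by (metis order_refl)
  qed
  have "f p \<in> graph_space ?I" if p: "p \<in> graph_space G" for p
  proof -
    consider v where "v \<in> verts G" "p = vertex_point v"
      | e where "e \<in> edges G" "p \<in> edge_space e"
      using p unfolding graph_space_def by blast
    then show ?thesis
    proof cases
      case 1
      then show ?thesis using verts unfolding graph_space_def by blast
    next
      case (2 e)
      obtain u v where uv: "e = {u, v}" using G 2(1) by (rule is_graph_edgeE)
      then obtain w where "walk ?I w" "f ` edge_space e = walk_space w"
        using edges 2(1) by blast
      then show ?thesis using 2(2) walk_space_subset_graph_space by blast
    qed
  qed
  then have "f \<in> topspace (realisation G) \<rightarrow> graph_space ?I"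
    by (simp add: topspace_realisation)
  moreover have "continuous_map (realisation G) (realisation H) f"
    using f by (simp add: wiring_def)
  ultimately have "continuous_map (realisation G) (realisation ?I) f"
    by (intro continuous_map_into_subgraph[OF H subgraph_wiring_image[OF H]])
  with verts edges show ?thesis unfolding wiring_def by blast
qed

text \<open>There are finitely many edges, each mapped onto the trace of a finite list of vertices,
  and vertex points determine their vertices.\<close>

lemma finite_verts_wiring_image:
  assumes G: "is_graph G" "finite (verts G)" and f: "wiring G H f"
  shows "finite (verts (wiring_image G H f))"
proof -
  have "finite {y. vertex_point y \<in> f ` edge_space e}" if "e \<in> edges G" for e
  proof -
    obtain u v where uv: "e = {u, v}" using G(1) \<open>e \<in> edges G\<close> by (rule is_graph_edgeE)
    have "{u, v} \<in> edges G" using that uv by simp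
    with f obtain w where "f ` edge_space {u, v} = walk_space w" by (rule wiring_edgeE)
    then show ?thesis by (simp add: uv vertex_point_in_walk_space_iff)
  qed
  then have "finite (\<Union>e\<in>edges G. {y. vertex_point y \<in> f ` edge_space e})"
    using finite_edges[OF G] by blast
  moreover have "finite (vertex_point -` f ` vertex_point ` verts G)"
    using G(2) by (intro finite_vimageI) (auto simp: inj_def)
  ultimately show ?thesis
    by (rule finite_subset[rotated, OF finite_UnI]) (auto simp: wiring_image_def)
qed

section \<open>Composition of wirings\<close>

text \<open>Induction along the walk, concatenating the walks that trace the images of its edges.
  They fit together because each joins the images of the endpoints of its edge.\<close>

lemma wiring_image_of_walk:
  assumes g: "wiring G H g" and w: "walk G w"
  shows "\<exists>w'. walk H w' \<and> g (vertex_point (hd w)) = vertex_point (hd w') \<and>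
    g (vertex_point (last w)) = vertex_point (last w') \<and> g ` walk_space w = walk_space w'"
proof -
  have "w \<noteq> []" using w by (simp add: walk_def)
  then show ?thesis using w
  proof (induction w rule: list_nonempty_induct)
    case (single x)
    then obtain y where "y \<in> verts H" "g (vertex_point x) = vertex_point y"
      using g unfolding wiring_def by auto
    \<comment> \<open>A walk of length zero is mapped to a walk of length zero.\<close>
    then show ?case by (intro exI[of _ "[y]"]) simp
  next
    case (cons x xs)
    then have x: "{x, hd xs} \<in> edges G" and xs: "walk G xs" by (auto simp: walk_Cons)
    obtain v where v: "walk H v" "g (vertex_point x) = vertex_point (hd v)"
      "g (vertex_point (hd xs)) = vertex_point (last v)" "g ` edge_space {x, hd xs} = walk_space v"
      using g x by (rule wiring_edgeE)
    obtain w' where w': "walk H w'" "g (vertex_point (hd xs)) = vertex_point (hd w')"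
      "g (vertex_point (last xs)) = vertex_point (last w')" "g ` walk_space xs = walk_space w'"
      using cons.IH xs by blast
    have "last v = hd w'" using v(3) w'(2) by simp
    note app = walk_append[OF v(1) w'(1) this]
    show ?case
      using app cons.hyps v w'
      by (intro exI[of _ "v @ tl w'"]) (simp add: walk_space_Cons image_Un)
  qed
qed

lemma wiring_comp:
  assumes f: "wiring G H f" and g: "wiring H K g"
  shows "wiring G K (g \<circ> f)"
  unfolding wiring_def
proof (intro conjI allI impI ballI)
  show "continuous_map (realisation G) (realisation K) (g \<circ> f)"
    using f g unfolding wiring_def by (blast intro: continuous_map_compose)
  show "(g \<circ> f) (vertex_point v) \<in> vertex_point ` verts K" if "v \<in> verts G" for v
    using f g that unfolding wiring_def by fastforce
  fix u v assume "{u, v} \<in> edges G"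
  with f obtain w where "walk H w" "f (vertex_point u) = vertex_point (hd w)"
    "f (vertex_point v) = vertex_point (last w)" "f ` edge_space {u, v} = walk_space w"
    by (rule wiring_edgeE)
  then show "\<exists>w. walk K w \<and> (g \<circ> f) (vertex_point u) = vertex_point (hd w) \<and>
      (g \<circ> f) (vertex_point v) = vertex_point (last w) \<and>
      (g \<circ> f) ` edge_space {u, v} = walk_space w"
    using wiring_image_of_walk[OF g] unfolding image_comp[symmetric] o_apply by metis
qed

lemma wiring_walk_over_edge:
  assumes K: "is_graph K" and g: "wiring H K g" and w: "walk H w" and d: "d \<in> edges K"
    and sub: "edge_space d \<subseteq> g ` walk_space w"
  obtains i where "Suc i < length w" "edge_space d \<subseteq> g ` edge_space {w ! i, w ! Suc i}"
proof -
  obtain a b where ab: "d = {a, b}" "a \<noteq> b" using K d by (rule is_graph_edgeE)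
  let ?m = "edge_point a b (1/2)"
  have "?m \<in> g ` walk_space w" using sub ab edge_point_in_edge_space[of "1/2" a b] by auto
  \<comment> \<open>Vertices go to vertices, so the midpoint \<open>?m\<close> must be reached from
    an edge of the walk.\<close>
  moreover have "?m \<noteq> g (vertex_point x)" if x: "x \<in> set w" for x
  proof -
    have "x \<in> verts H" using w x unfolding walk_def by blast
    then show ?thesis
      using g edge_point_interior_neq_vertex_point[OF ab(2), of "1/2"]
      unfolding wiring_def by fastforce
  qed
  ultimately obtain i where i: "Suc i < length w" "?m \<in> g ` edge_space {w ! i, w ! Suc i}"
    unfolding walk_space_def by auto
  \<comment> \<open>The image of this edge is itself traced by a walk, so containing the midpoint it
    contains all of \<open>d\<close>.\<close>
  have "{w ! i, w ! Suc i} \<in> edges H" using w i(1) by (simp add: walk_def)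
  with g obtain w' where "g ` edge_space {w ! i, w ! Suc i} = walk_space w'"
    by (rule wiring_edgeE)
  then show thesis
    using that i ab interior_in_walk_space[OF ab(2), of "1/2" w'] by simp
qed

text \<open>The common count behind both multiplicity conditions of a composite: at most
  \<open>l\<close> intermediate objects, each with at most \<open>k\<close> objects above
  it.\<close>

lemma card_fibres_le:
  assumes "finite B" "card B \<le> l" and "S \<subseteq> (\<Union>y\<in>B. A y)"
    and "\<And>y. y \<in> B \<Longrightarrow> finite (A y) \<and> card (A y) \<le> k"
  shows "finite S \<and> card S \<le> k * l"
proof
  have fin: "finite (\<Union>y\<in>B. A y)" using assms by blast
  then show "finite S" using assms(3) finite_subset by blast
  have "card S \<le> card (\<Union>y\<in>B. A y)" using fin assms(3) by (rule card_mono)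
  also have "\<dots> \<le> (\<Sum>y\<in>B. card (A y))" using assms(1) by (rule card_UN_le)
  also have "\<dots> \<le> card B * k" using assms(4) sum_bounded_above[of B "\<lambda>y. card (A y)" k] by simp
  also have "\<dots> \<le> k * l" using assms(2) by (simp add: mult.commute)
  finally show "card S \<le> k * l" .
qed

text \<open>The counted sets stay the same; only fewer vertices and edges of the target have to be
  checked.\<close>

lemma coarse_wiring_into_image:
  assumes "is_graph G" "is_graph H" "coarse_wiring k G H f"
  shows "coarse_wiring k G (wiring_image G H f) f"
  using assms wiring_into_image[of G H f] unfolding coarse_wiring_def
  by (auto simp: wiring_image_def)

lemma coarse_wiring_comp:
  assumes G: "is_graph G" and K: "is_graph K"
    and f: "coarse_wiring k G H f" and g: "coarse_wiring l H K g"
  shows "coarse_wiring (k * l) G K (g \<circ> f)"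
proof -
  have wf: "wiring G H f" and wg: "wiring H K g"
    using f g by (auto simp: coarse_wiring_def)
  have "finite {x \<in> verts G. (g \<circ> f) (vertex_point x) = vertex_point z} \<and>
      card {x \<in> verts G. (g \<circ> f) (vertex_point x) = vertex_point z} \<le> k * l"
    if z: "z \<in> verts K" for z
  proof (rule card_fibres_le)
    \<comment> \<open>The vertices over \<open>z\<close> are grouped by their image \<open>y\<close>
      under \<open>f\<close>.\<close>
    let ?B = "{y \<in> verts H. g (vertex_point y) = vertex_point z}"
    let ?A = "\<lambda>y. {x \<in> verts G. f (vertex_point x) = vertex_point y}"
    show "finite ?B" "card ?B \<le> l" using g z by (auto simp: coarse_wiring_def)
    show "finite (?A y) \<and> card (?A y) \<le> k" if "y \<in> ?B" for y
      using f that by (auto simp: coarse_wiring_def)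
    show "{x \<in> verts G. (g \<circ> f) (vertex_point x) = vertex_point z} \<subseteq> (\<Union>y\<in>?B. ?A y)"
      using wf unfolding wiring_def by fastforce
  qed
  moreover have "finite {e \<in> edges G. edge_space d \<subseteq> (g \<circ> f) ` edge_space e} \<and>
      card {e \<in> edges G. edge_space d \<subseteq> (g \<circ> f) ` edge_space e} \<le> k * l"
    if d: "d \<in> edges K" for d
  proof (rule card_fibres_le)
    let ?B = "{c \<in> edges H. edge_space d \<subseteq> g ` edge_space c}"
    let ?A = "\<lambda>c. {e \<in> edges G. edge_space c \<subseteq> f ` edge_space e}"
    show "finite ?B" "card ?B \<le> l" using g d by (auto simp: coarse_wiring_def)
    show "finite (?A y) \<and> card (?A y) \<le> k" if "y \<in> ?B" for y
      using f that by (auto simp: coarse_wiring_def)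
    \<comment> \<open>The sets \<open>?A c\<close> may overlap, as \<open>f\<close> can carry
      \<open>e\<close> over several edges that \<open>g\<close> maps over \<open>d\<close>; finding
      one such edge on the walk \<open>f e\<close> is enough.\<close>
    show "{e \<in> edges G. edge_space d \<subseteq> (g \<circ> f) ` edge_space e} \<subseteq> (\<Union>c\<in>?B. ?A c)"
    proof
      fix e assume "e \<in> {e \<in> edges G. edge_space d \<subseteq> (g \<circ> f) ` edge_space e}"
      then have e: "e \<in> edges G" "edge_space d \<subseteq> g ` f ` edge_space e"
        by (auto simp: image_comp)
      obtain u v where uv: "e = {u, v}" using G e(1) by (rule is_graph_edgeE)
      have "{u, v} \<in> edges G" using e(1) uv by simp
      with wf obtain w where w: "walk H w" "f ` edge_space {u, v} = walk_space w"
        by (rule wiring_edgeE)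
      have "edge_space d \<subseteq> g ` walk_space w" using e(2) w(2) uv by simp
      with K wg w(1) d obtain i where
        i: "Suc i < length w" "edge_space d \<subseteq> g ` edge_space {w ! i, w ! Suc i}"
        by (rule wiring_walk_over_edge)
      have "{w ! i, w ! Suc i} \<in> ?B" using i w(1) by (simp add: walk_def)
      moreover have "e \<in> ?A {w ! i, w ! Suc i}"
        using e(1) uv w(2) edge_space_subset_walk_space[OF i(1)] by simp
      ultimately show "e \<in> (\<Union>c\<in>?B. ?A c)" by blast
    qed
  qed
  ultimately show ?thesis
    using wiring_comp[OF wf wg] unfolding coarse_wiring_def by blast
qed

text \<open>Bounds the volume of the composite by that of \<open>g\<close>: whatever
  \<open>g \<circ> f\<close> hits is hit by \<open>g\<close> at a point of the realisation of
  \<open>H\<close>. That point may lie inside an edge, and such vertices also count in the image of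
  \<open>g\<close>.\<close>

lemma verts_wiring_image_comp:
  assumes G: "is_graph G" and f: "wiring G H f"
  shows "verts (wiring_image G K (g \<circ> f)) \<subseteq> verts (wiring_image H K g)"
proof
  fix z assume z: "z \<in> verts (wiring_image G K (g \<circ> f))"
  then have zK: "z \<in> verts K" by (simp add: wiring_image_def)
  consider x where "x \<in> verts G" "vertex_point z = g (f (vertex_point x))"
    | e where "e \<in> edges G" "vertex_point z \<in> g ` f ` edge_space e"
    using z unfolding wiring_image_def by auto
  then show "z \<in> verts (wiring_image H K g)"
  proof cases
    case (1 x)
    then obtain y where "y \<in> verts H" "f (vertex_point x) = vertex_point y"
      using f unfolding wiring_def by blast
    with 1 zK show ?thesis unfolding wiring_image_def by auto
  next
    case (2 e)
    obtain u v where uv: "e = {u, v}" using G 2(1) by (rule is_graph_edgeE)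
    have "{u, v} \<in> edges G" using 2(1) uv by simp
    with f obtain w where w: "walk H w" "f ` edge_space {u, v} = walk_space w"
      by (rule wiring_edgeE)
    then have "vertex_point z \<in> g ` graph_space H"
      using 2(2) uv walk_space_subset_graph_space[OF w(1)] by auto
    with zK show ?thesis unfolding wiring_image_def graph_space_def by auto
  qed
qed

section \<open>Wiring profiles\<close>

lemma wir_attained:
  assumes "wir k G H \<noteq> \<infinity>"
  obtains f where "coarse_wiring k G H f" "wir k G H = enat (wiring_volume G H f)"
proof -
  let ?S = "(\<lambda>f. enat (wiring_volume G H f)) ` {f. coarse_wiring k G H f}"
  \<comment> \<open>The infimum of the empty set would be \<infinity>; a nonempty set of extended
    naturals has a least element.\<close>
  have "?S \<noteq> {}" using assms unfolding wir_def by (metis Inf_enat_def)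
  then have "Inf ?S \<in> ?S" unfolding Inf_enat_def by (auto intro: LeastI)
  then show thesis using that unfolding wir_def by auto
qed

lemma wir_le: "coarse_wiring k G H f \<Longrightarrow> wir k G H \<le> enat (wiring_volume G H f)"
  unfolding wir_def by (rule INF_lower) simp

lemma wir_le_wiring_profile:
  "subgraph G X \<Longrightarrow> finite (verts G) \<Longrightarrow> card (verts G) \<le> n \<Longrightarrow>
    wir k G Y \<le> wiring_profile k X Y n"
  unfolding wiring_profile_def by (rule SUP_upper) simp

theorem proposition1p13:
  fixes X :: "'a graph" and Y :: "'b graph" and Z :: "'c graph" and k l :: nat
  assumes "is_graph X" and "is_graph Y" and "is_graph Z"
    and "\<forall>n. wiring_profile k X Y n \<noteq> \<infinity>"
    and "\<forall>n. wiring_profile l Y Z n \<noteq> \<infinity>"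
  shows "\<forall>n. wiring_profile (k * l) X Z n \<le>
           wiring_profile l Y Z (the_enat (wiring_profile k X Y n))"
proof
  fix n
  obtain N where N: "wiring_profile k X Y n = enat N" using assms(4) by blast
  have "wir (k * l) G Z \<le> wiring_profile l Y Z N"
    if "subgraph G X" "finite (verts G)" "card (verts G) \<le> n" for G
  proof -
    have G: "is_graph G" using that(1) by (simp add: subgraph_def)
    have le: "wir k G Y \<le> enat N" using wir_le_wiring_profile[OF that] N by metis
    then have "wir k G Y \<noteq> \<infinity>" by (metis enat_ord_simps(5) enat.distinct(1))
    then obtain f where f: "coarse_wiring k G Y f" "wir k G Y = enat (wiring_volume G Y f)"
      by (rule wir_attained)
    \<comment> \<open>The intermediate graph is the image of \<open>f\<close>: its number of
      vertices is the volume of \<open>f\<close>, at most \<open>N\<close>, so the profile of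
      \<open>Y\<close> into \<open>Z\<close> at \<open>N\<close> applies to it.\<close>
    define H where "H = wiring_image G Y f"
    have H: "subgraph H Y" "finite (verts H)" "card (verts H) \<le> N"
      using subgraph_wiring_image[OF assms(2)] finite_verts_wiring_image[OF G that(2)] f le
      unfolding H_def coarse_wiring_def by (auto simp: wiring_volume_def)
    then have isH: "is_graph H" by (simp add: subgraph_def)
    have le': "wir l H Z \<le> wiring_profile l Y Z N" using H by (rule wir_le_wiring_profile)
    then have "wir l H Z \<noteq> \<infinity>" using assms(5) by (metis enat_ord_simps(5))
    then obtain g where g: "coarse_wiring l H Z g" "wir l H Z = enat (wiring_volume H Z g)"
      by (rule wir_attained)
    have fH: "coarse_wiring k G H f"
      using coarse_wiring_into_image[OF G assms(2) f(1)] by (simp add: H_def)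
    have "wir (k * l) G Z \<le> enat (wiring_volume G Z (g \<circ> f))"
      using coarse_wiring_comp[OF G assms(3) fH g(1)] by (rule wir_le)
    \<comment> \<open>Finiteness of the image of \<open>g\<close> is essential here, since
      \<open>card\<close> is 0 on infinite sets and monotone only below a finite set.\<close>
    also have "\<dots> \<le> enat (wiring_volume H Z g)"
      using verts_wiring_image_comp[OF G, of H f Z g]
        finite_verts_wiring_image[OF isH H(2), of Z g] fH g(1)
      unfolding wiring_volume_def coarse_wiring_def by (simp add: card_mono)
    finally show ?thesis using g(2) le' by simp
  qed
  then show "wiring_profile (k * l) X Z n \<le>
      wiring_profile l Y Z (the_enat (wiring_profile k X Y n))"
    unfolding N wiring_profile_def[of "k * l"] by (auto intro: SUP_least)
qed

end
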